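(* Let $T = [0,1]$ (the real unit interval) be the semiring equipped with addition $a \oplus b = \max(a,b)$ and multiplication defined by $a \odot b = 0$ for all $a,b \in [0,1)$, with $1 \odot a = a \odot 1 = a$ for all $a \in T$. The subtractive closure operator $\operatorname{scl}_T$ distributes over ideal multiplication; that is, for any ideals $I, J$ of $T$, \[ \operatorname{scl}_T(I \odot J) = \operatorname{scl}_T(I) \odot \operatorname{scl}_T(J). \]
   Context: The additive identity (zero) of $T$ is the number $0$ and the multiplicative identity is the number $1$. An ideal of $T$ is a nonempty subset $I$ with $a\oplus b\in I$ and $t\odot a\in I$ for all $a,b\in I$, $t\in T$. An ideal $I$ is subtractive if $x\oplus y\in I$ and $x\in I$ imply $y\in I$, for all $x,y\in T$. $\operatorname{scl}_T(I)$ is the intersection of all subtractive ideals of $T$ containing $I$. For ideals $I,J$ of $T$, the ideal product $I\odot J$ is the set of all finite $\oplus$-sums of elements $i\odot j$ with $i\in I$, $j\in J$. *)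

theory Defs
  imports Complex_Main "HOL-Algebra.Ring"
begin

text \<open>The library's ideals are ideals of rings, so ideals of a semiring are defined here. The
  semiring considered is commutative, hence absorption is required on one side only.\<close>

definition semiring_ideal :: "('a, 'm) ring_scheme \<Rightarrow> 'a set \<Rightarrow> bool" where
  "semiring_ideal R I \<longleftrightarrow>
     I \<subseteq> carrier R \<and> I \<noteq> {} \<and>
     (\<forall>a\<in>I. \<forall>b\<in>I. a \<oplus>\<^bsub>R\<^esub> b \<in> I) \<and>
     (\<forall>t\<in>carrier R. \<forall>a\<in>I. t \<otimes>\<^bsub>R\<^esub> a \<in> I)"

definition subtractive_ideal :: "('a, 'm) ring_scheme \<Rightarrow> 'a set \<Rightarrow> bool" where
  "subtractive_ideal R I \<longleftrightarrow>
     semiring_ideal R I \<and>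
     (\<forall>x\<in>carrier R. \<forall>y\<in>carrier R. x \<oplus>\<^bsub>R\<^esub> y \<in> I \<and> x \<in> I \<longrightarrow> y \<in> I)"

definition scl :: "('a, 'm) ring_scheme \<Rightarrow> 'a set \<Rightarrow> 'a set" where
  "scl R I = \<Inter> {K. subtractive_ideal R K \<and> I \<subseteq> K}"

text \<open>The empty sum (\<open>n = 0\<close>) is allowed; it adds nothing when \<open>I\<close> and \<open>J\<close> are
  ideals, since then both contain zero.\<close>

definition semiring_ideal_prod :: "('a, 'm) ring_scheme \<Rightarrow> 'a set \<Rightarrow> 'a set \<Rightarrow> 'a set" where
  "semiring_ideal_prod R I J =
     {(\<Oplus>\<^bsub>R\<^esub>k\<in>{..<n}. f k \<otimes>\<^bsub>R\<^esub> g k) | (n::nat) f g.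
        (\<forall>k<n. f k \<in> I) \<and> (\<forall>k<n. g k \<in> J)}"

definition interval_semiring :: "real ring" where
  "interval_semiring =
     \<lparr>carrier = {0..1},
      mult = (\<lambda>a b. if a = 1 then b else if b = 1 then a else 0),
      one = 1,
      zero = 0,
      add = max\<rparr>"

lemma semiring_interval_semiring: "semiring interval_semiring"
  by unfold_locales (auto simp: interval_semiring_def max_def Units_def)

lemma interval_semiring_mult_comm:
  assumes "a \<in> carrier interval_semiring" "b \<in> carrier interval_semiring"
  shows "a \<otimes>\<^bsub>interval_semiring\<^esub> b = b \<otimes>\<^bsub>interval_semiring\<^esub> a"
  using assms by (auto simp: interval_semiring_def)

lemma subtractive_ideal_carrier:
  assumes "semiring R"
  shows "subtractive_ideal R (carrier R)"
proof -
  interpret semiring R by fact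
  show ?thesis by (auto simp: subtractive_ideal_def semiring_ideal_def)
qed

end

theory Submission
  imports Defs
begin

text \<open>An ideal containing \<open>1\<close> is the whole semiring, which is the unit for the product of
  ideals, so both sides are the closure of the other factor. If neither ideal contains \<open>1\<close>, both
  closures stay inside the subtractive ideal \<open>[0,1)\<close>, where all products vanish; both sides are
  then the zero ideal.\<close>

lemma semiring_ideal_zero:
  assumes "semiring R" "semiring_ideal R I"
  shows "\<zero>\<^bsub>R\<^esub> \<in> I"
proof -
  interpret semiring R by fact
  obtain a where a: "a \<in> I" "a \<in> carrier R"
    using assms(2) unfolding semiring_ideal_def by blast
  then have "\<zero>\<^bsub>R\<^esub> \<otimes>\<^bsub>R\<^esub> a \<in> I"
    using assms(2) zero_closed unfolding semiring_ideal_def by blast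
  with a show ?thesis by simp
qed

lemma semiring_ideal_one_imp_carrier:
  assumes "semiring R" "semiring_ideal R I" "\<one>\<^bsub>R\<^esub> \<in> I"
  shows "I = carrier R"
proof -
  interpret semiring R by fact
  have "x \<in> I" if "x \<in> carrier R" for x
  proof -
    have "x \<otimes>\<^bsub>R\<^esub> \<one>\<^bsub>R\<^esub> \<in> I"
      using assms(2,3) that unfolding semiring_ideal_def by blast
    with that show ?thesis by simp
  qed
  with assms(2) show ?thesis
    unfolding semiring_ideal_def by blast
qed

lemma scl_superset: "I \<subseteq> scl R I"
  by (auto simp: scl_def)

lemma scl_minimal:
  assumes "subtractive_ideal R K" "I \<subseteq> K"
  shows "scl R I \<subseteq> K"
  using assms by (auto simp: scl_def)

lemma scl_carrier:
  assumes "semiring R"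
  shows "scl R (carrier R) = carrier R"
  by (intro subset_antisym scl_superset scl_minimal subtractive_ideal_carrier assms subset_refl)

text \<open>Each closure property of ideals passes to an intersection. The carrier is itself a
  subtractive ideal containing \<open>I\<close>, which bounds the intersection; \<open>I\<close>
  inside it makes it nonempty.\<close>

lemma scl_ideal:
  assumes "semiring R" "semiring_ideal R I"
  shows "semiring_ideal R (scl R I)"
proof -
  have "scl R I \<subseteq> carrier R"
    using assms(2) unfolding semiring_ideal_def
    by (intro scl_minimal subtractive_ideal_carrier assms(1)) blast
  moreover have "scl R I \<noteq> {}"
    using assms(2) scl_superset[of I R] unfolding semiring_ideal_def by blast
  moreover have "a \<oplus>\<^bsub>R\<^esub> b \<in> scl R I" if "a \<in> scl R I" "b \<in> scl R I" for a b
    using that unfolding scl_def subtractive_ideal_def semiring_ideal_def by blast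
  moreover have "t \<otimes>\<^bsub>R\<^esub> a \<in> scl R I" if "t \<in> carrier R" "a \<in> scl R I" for t a
    using that unfolding scl_def subtractive_ideal_def semiring_ideal_def by blast
  ultimately show ?thesis
    unfolding semiring_ideal_def by blast
qed

lemma semiring_ideal_finsum:
  assumes "semiring R" "semiring_ideal R I" "finite A" "\<And>k. k \<in> A \<Longrightarrow> f k \<in> I"
  shows "(\<Oplus>\<^bsub>R\<^esub>k\<in>A. f k) \<in> I"
proof -
  interpret semiring R by fact
  have sub: "I \<subseteq> carrier R" using assms(2) by (auto simp: semiring_ideal_def)
  show ?thesis
    using assms(3,4)
  proof (induction A rule: finite_induct)
    case empty
    then show ?case using semiring_ideal_zero[OF assms(1,2)] by simp
  next
    case (insert x A)
    \<comment> \<open>\<open>finsum\<close> splits off the term at \<open>x\<close> only when all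
      summands are known to lie in the carrier.\<close>
    then have "f \<in> A \<rightarrow> carrier R" "f x \<in> carrier R" using sub by auto
    with insert show ?case using assms(2) by (auto simp: semiring_ideal_def)
  qed
qed

text \<open>Absorption keeps each term of a sum in \<open>J\<close>; conversely, \<open>x\<close> is
  the one-term sum of \<open>\<one> \<otimes> x\<close>.\<close>

lemma semiring_ideal_prod_carrier:
  assumes "semiring R" "semiring_ideal R J"
  shows "semiring_ideal_prod R (carrier R) J = J"
proof
  show "semiring_ideal_prod R (carrier R) J \<subseteq> J"
  proof
    fix x assume "x \<in> semiring_ideal_prod R (carrier R) J"
    then obtain n :: nat and f g where "x = (\<Oplus>\<^bsub>R\<^esub>k\<in>{..<n}. f k \<otimes>\<^bsub>R\<^esub> g k)"
      "\<forall>k<n. f k \<in> carrier R" "\<forall>k<n. g k \<in> J"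
      unfolding semiring_ideal_prod_def by blast
    then show "x \<in> J"
      using semiring_ideal_finsum[OF assms, of "{..<n}" "\<lambda>k. f k \<otimes>\<^bsub>R\<^esub> g k"] assms(2)
      by (auto simp: semiring_ideal_def)
  qed
  interpret semiring R by fact
  show "J \<subseteq> semiring_ideal_prod R (carrier R) J"
  proof
    fix x assume x: "x \<in> J"
    then have "x \<in> carrier R" using assms(2) by (auto simp: semiring_ideal_def)
    then have "x = (\<Oplus>\<^bsub>R\<^esub>k\<in>{..<1::nat}. \<one>\<^bsub>R\<^esub> \<otimes>\<^bsub>R\<^esub> x)"
      by (simp add: lessThan_Suc)
    with x show "x \<in> semiring_ideal_prod R (carrier R) J"
      unfolding semiring_ideal_prod_def
      by (intro CollectI exI[of _ "1::nat"] exI[of _ "\<lambda>_. \<one>\<^bsub>R\<^esub>"] exI[of _ "\<lambda>_. x"]) simp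
  qed
qed

text \<open>The factors are exchanged term by term. Commutativity appears as a hypothesis because
  multiplication in a \<open>semiring\<close> need not commute.\<close>

lemma semiring_ideal_prod_commute:
  assumes "semiring R" "I \<subseteq> carrier R" "J \<subseteq> carrier R"
    and comm: "\<And>a b. a \<in> carrier R \<Longrightarrow> b \<in> carrier R \<Longrightarrow> a \<otimes>\<^bsub>R\<^esub> b = b \<otimes>\<^bsub>R\<^esub> a"
  shows "semiring_ideal_prod R I J = semiring_ideal_prod R J I"
proof -
  interpret semiring R by fact
  have "semiring_ideal_prod R A B \<subseteq> semiring_ideal_prod R B A"
    if "A \<subseteq> carrier R" "B \<subseteq> carrier R" for A B
  proof
    fix x assume "x \<in> semiring_ideal_prod R A B"
    then obtain n :: nat and f g where x: "x = (\<Oplus>\<^bsub>R\<^esub>k\<in>{..<n}. f k \<otimes>\<^bsub>R\<^esub> g k)"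
      and fg: "\<forall>k<n. f k \<in> A" "\<forall>k<n. g k \<in> B"
      unfolding semiring_ideal_prod_def by blast
    have car: "f k \<in> carrier R" "g k \<in> carrier R" if "k < n" for k
      using that fg \<open>A \<subseteq> carrier R\<close> \<open>B \<subseteq> carrier R\<close> by auto
    have "x = (\<Oplus>\<^bsub>R\<^esub>k\<in>{..<n}. g k \<otimes>\<^bsub>R\<^esub> f k)"
      unfolding x by (rule finsum_cong') (auto simp: car comm)
    with fg show "x \<in> semiring_ideal_prod R B A"
      unfolding semiring_ideal_prod_def by blast
  qed
  with assms(2,3) show ?thesis by blast
qed

text \<open>If \<open>max x y < 1\<close> then \<open>y < 1\<close>, and multiplying
  \<open>a < 1\<close> by any element gives \<open>a\<close> or \<open>0\<close>. This ideal is what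
  keeps 1 out of the closure of an ideal without 1.\<close>

lemma subtractive_ideal_unit_interval_below_one:
  "subtractive_ideal interval_semiring {0..<1}"
  by (auto simp: subtractive_ideal_def semiring_ideal_def interval_semiring_def)

text \<open>The carrier has no negative elements, so \<open>max x y = 0\<close> forces
  \<open>y = 0\<close>.\<close>

lemma subtractive_ideal_interval_zero: "subtractive_ideal interval_semiring {0}"
  by (auto simp: subtractive_ideal_def semiring_ideal_def interval_semiring_def)

text \<open>Two factors below 1 fall into the last branch of the multiplication, and the ideal
  \<open>{0}\<close> is closed under finite sums. The result serves both for the given ideals and
  for their closures.\<close>

lemma interval_ideal_prod_below_one:
  assumes "I \<subseteq> {0..<1}" "J \<subseteq> {0..<1}"
  shows "semiring_ideal_prod interval_semiring I J = {0}"
proof -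
  interpret semiring interval_semiring by (rule semiring_interval_semiring)
  have "x = 0" if "x \<in> semiring_ideal_prod interval_semiring I J" for x
  proof -
    from that obtain n :: nat and f g
      where x: "x = (\<Oplus>\<^bsub>interval_semiring\<^esub>k\<in>{..<n}. f k \<otimes>\<^bsub>interval_semiring\<^esub> g k)"
        and fg: "\<forall>k<n. f k \<in> I" "\<forall>k<n. g k \<in> J"
      unfolding semiring_ideal_prod_def by blast
    have "f k \<otimes>\<^bsub>interval_semiring\<^esub> g k \<in> {0}" if "k < n" for k
      using that fg assms by (force simp: interval_semiring_def)
    then show ?thesis
      using semiring_ideal_finsum[OF semiring_interval_semiring, of "{0}" "{..<n}"
          "\<lambda>k. f k \<otimes>\<^bsub>interval_semiring\<^esub> g k"] subtractive_ideal_interval_zero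
      by (simp add: subtractive_ideal_def x)
  qed
  \<comment> \<open>The witness is the empty sum, whose value is the zero of the semiring; unfolding
    the record then identifies it with the number 0.\<close>
  moreover have "0 \<in> semiring_ideal_prod interval_semiring I J"
    unfolding semiring_ideal_prod_def
    by (intro CollectI exI[of _ "0::nat"]) (simp, simp add: interval_semiring_def)
  ultimately show ?thesis by blast
qed

theorem theorem5p6:
  fixes I J :: "real set"
  assumes "semiring_ideal interval_semiring I"
    and "semiring_ideal interval_semiring J"
  shows "scl interval_semiring (semiring_ideal_prod interval_semiring I J) =
         semiring_ideal_prod interval_semiring
           (scl interval_semiring I) (scl interval_semiring J)"
proof -
  let ?T = interval_semiring
  note T = semiring_interval_semiring
  have one: "\<one>\<^bsub>?T\<^esub> = 1" and car: "carrier ?T = {0..1}"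
    by (simp_all add: interval_semiring_def)
  \<comment> \<open>Here \<open>A\<close> and its closure are the carrier, so both sides reduce to
    \<open>scl ?T B\<close>. The factors are kept general so that \<open>I\<close> and
    \<open>J\<close> can be exchanged later.\<close>
  have unit: "scl ?T (semiring_ideal_prod ?T A B) = semiring_ideal_prod ?T (scl ?T A) (scl ?T B)"
    if "semiring_ideal ?T A" "semiring_ideal ?T B" "1 \<in> A" for A B
  proof -
    have "A = carrier ?T"
      using semiring_ideal_one_imp_carrier[OF T that(1)] that(3) unfolding one by blast
    then show ?thesis
      using that(2) by (simp add: scl_carrier[OF T] semiring_ideal_prod_carrier[OF T] scl_ideal[OF T])
  qed
  have commute: "semiring_ideal_prod ?T A B = semiring_ideal_prod ?T B A"
    if "semiring_ideal ?T A" "semiring_ideal ?T B" for A B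
    using that by (intro semiring_ideal_prod_commute T interval_semiring_mult_comm)
      (auto simp: semiring_ideal_def)
  consider "1 \<in> I" | "1 \<in> J" | "1 \<notin> I" "1 \<notin> J" by blast
  then show ?thesis
  proof cases
    case 1
    then show ?thesis using unit assms by blast
  next
    case 2
    \<comment> \<open>The unit case is applied with the factors exchanged; commutativity then
      restores the order, once for \<open>I\<close> and \<open>J\<close> and once for their
      closures.\<close>
    then show ?thesis
      using unit[OF assms(2,1)] commute[OF assms]
        commute[OF scl_ideal[OF T assms(1)] scl_ideal[OF T assms(2)]] by metis
  next
    case 3
    have below: "A \<subseteq> {0..<1}" if A: "semiring_ideal ?T A" "1 \<notin> A" for A
    proof
      fix x assume "x \<in> A"
      with A have "x \<in> {0..1}" "x \<noteq> 1" by (auto simp: semiring_ideal_def car)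
      then show "x \<in> {0..<1}" by auto
    qed
    have sub: "I \<subseteq> {0..<1}" "J \<subseteq> {0..<1}"
      using below 3 assms by blast+
    \<comment> \<open>On the left the product is already \<open>{0}\<close>, so only its closure
      remains to be found.\<close>
    have "scl ?T {0} = {0}"
      using scl_superset[of "{0}" ?T] scl_minimal[OF subtractive_ideal_interval_zero, of "{0}"]
      by blast
    moreover have "scl ?T I \<subseteq> {0..<1}" "scl ?T J \<subseteq> {0..<1}"
      using sub by (simp_all add: scl_minimal[OF subtractive_ideal_unit_interval_below_one])
    ultimately show ?thesis
      using sub by (simp add: interval_ideal_prod_below_one)
  qed
qed

end
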